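(* If a labelled sequent $S$ is derivable in $\mathbf{GA_l}$, then $\models_{\mathbf{A}} S$.
   Context: Formulas are built from propositional variables and $t$ using $+,\to,\Rightarrow$ (binary) and $\lnot$; under a valuation $v$ into $\mathbb{Q}$: $v(t)=0$, $v(A+B)=v(A)+v(B)$, $v(\lnot A)=-v(A)$, $v(A\to B)=v(B)-v(A)$, $v(A\Rightarrow B)=\min(0,v(B)-v(A))$ (i.e. $A\Rightarrow B=(A\to B)\land t$). Labels are generated from the unit label $1$ and atomic labels $x_1,x_2,\ldots$ by concatenation $xy$. A labelled formula is $x:A$ with $x$ a label; a labelled sequent $\Gamma\vdash\Delta$ is a pair of finite multisets of labelled formulas. A labelling function $f$ maps labels to $\{0,1\}$ with $f(1)=1$ and $f(xy)=f(x)f(y)$; $f(\Gamma)$ is the multiset $\{A : x:A\in\Gamma, f(x)=1\}$. $\models_{\mathbf{A}}\Gamma\vdash\Delta$ means: for every valuation $v$ into $\mathbb{Q}$ there is a labelling function $f$ with $\sum_{A\in f(\Gamma)}v(A)\le\sum_{B\in f(\Delta)}v(B)$ (equivalently the disjunction over $f$ of the interpretations of $f(\Gamma)\vdash f(\Delta)$ is valid in abelian logic). Calculus $\mathbf{GA_l}$ (premise(s) / conclusion): $(t,l)$ $\Gamma\vdash\Delta/\Gamma,x:t\vdash\Delta$; $(t,r)$ $\Gamma\vdash\Delta/\Gamma\vdash x:t,\Delta$; $(\lnot,l)$ $\Gamma\vdash x:A,\Delta/\Gamma,x:\lnot A\vdash\Delta$; $(\lnot,r)$ $\Gamma,x:A\vdash\Delta/\Gamma\vdash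 x:\lnot A,\Delta$; $(+,l)$ $\Gamma,x:A,x:B\vdash\Delta/\Gamma,x:A+B\vdash\Delta$; $(+,r)$ $\Gamma\vdash\Delta,x:A,x:B/\Gamma\vdash\Delta,x:A+B$; $(\to,l)$ $\Gamma,x:B\vdash\Delta,x:A/\Gamma,x:A\to B\vdash\Delta$; $(\to,r)$ $\Gamma,x:A\vdash\Delta,x:B/\Gamma\vdash\Delta,x:A\to B$; $(\Rightarrow,l)$ $\Gamma,xy:B\vdash\Delta,xy:A/\Gamma,x:A\Rightarrow B\vdash\Delta$ where $y$ is an atomic label not occurring in the conclusion; $(\Rightarrow,r)$ two premises $\Gamma,x:A\vdash\Delta,x:B$ and $\Gamma\vdash\Delta$, conclusion $\Gamma\vdash\Delta,x:A\Rightarrow B$; (success) axiom $\Gamma\vdash\Delta$ whenever all formulas in $\Gamma,\Delta$ are propositional variables and there exist labelling functions $f_1,\ldots,f_n$ ($n\ge1$) with $\biguplus_{i=1}^n f_i(\Gamma)=\biguplus_{i=1}^n f_i(\Delta)$ (multiset union). *)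

theory Defs
  imports Complex_Main "HOL-Library.Multiset"
begin

datatype form =
    Var nat
  | Truth  ("\<^bold>t")
  | Add form form  (infixl "\<^bold>+" 65)
  | Imp form form  (infixr "\<^bold>\<rightarrow>" 60)
  | LImp form form  (infixr "\<^bold>\<Rightarrow>" 60)
  | Neg form  ("\<^bold>\<not> _" [70] 70)

primrec val :: "(nat \<Rightarrow> rat) \<Rightarrow> form \<Rightarrow> rat" where
  "val v (Var p) = v p"
| "val v \<^bold>t = 0"
| "val v (A \<^bold>+ B) = val v A + val v B"
| "val v (A \<^bold>\<rightarrow> B) = val v B - val v A"
| "val v (A \<^bold>\<Rightarrow> B) = min 0 (val v B - val v A)"
| "val v (\<^bold>\<not> A) = - val v A"

text \<open>Labels are terms, not words: \<open>Unit \<cdot> x\<close> and \<open>x\<close> are different labels. Rules and semantics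
  inspect labels only through labelling functions and the atoms occurring in them, so
  reading labels modulo the monoid laws gives the same calculus.\<close>

datatype label =
    Unit
  | Atom nat
  | Conc label label  (infixl "\<cdot>" 70)

primrec atoms_label :: "label \<Rightarrow> nat set" where
  "atoms_label Unit = {}"
| "atoms_label (Atom i) = {i}"
| "atoms_label (x \<cdot> y) = atoms_label x \<union> atoms_label y"

type_synonym lform = "label \<times> form"

type_synonym lsequent = "lform multiset \<times> lform multiset"

abbreviation lsequent_of :: "lform multiset \<Rightarrow> lform multiset \<Rightarrow> lsequent"  (infix "\<turnstile>" 50) where
  "\<Gamma> \<turnstile> \<Delta> \<equiv> (\<Gamma>, \<Delta>)"

definition atoms_mset :: "lform multiset \<Rightarrow> nat set" where
  "atoms_mset \<Gamma> = (\<Union>(x, A) \<in> set_mset \<Gamma>. atoms_label x)"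

primrec atoms_sequent :: "lsequent \<Rightarrow> nat set" where
  "atoms_sequent (\<Gamma> \<turnstile> \<Delta>) = atoms_mset \<Gamma> \<union> atoms_mset \<Delta>"

definition labelling :: "(label \<Rightarrow> nat) \<Rightarrow> bool" where
  "labelling f \<longleftrightarrow>
     (\<forall>x. f x \<in> {0, 1}) \<and> f Unit = 1 \<and> (\<forall>x y. f (x \<cdot> y) = f x * f y)"

definition select :: "(label \<Rightarrow> nat) \<Rightarrow> lform multiset \<Rightarrow> form multiset" where
  "select f \<Gamma> = {# A. (x, A) \<in># filter_mset (\<lambda>(x, A). f x = 1) \<Gamma> #}"

definition valid :: "lsequent \<Rightarrow> bool"  ("\<Turnstile>\<^sub>A _" [50] 50) where
  "\<Turnstile>\<^sub>A S \<longleftrightarrow>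
     (\<forall>v. \<exists>f. labelling f \<and>
        (\<Sum>A \<in># select f (fst S). val v A) \<le> (\<Sum>B \<in># select f (snd S). val v B))"

definition all_vars :: "lform multiset \<Rightarrow> bool" where
  "all_vars \<Gamma> \<longleftrightarrow> (\<forall>(x, A) \<in> set_mset \<Gamma>. \<exists>p. A = Var p)"

inductive GAl :: "lsequent \<Rightarrow> bool" where
  success:
    "\<lbrakk> all_vars \<Gamma>; all_vars \<Delta>; (n :: nat) \<ge> 1; \<forall>i \<in> {1..n}. labelling (f i);
       (\<Sum>i = 1..n. select (f i) \<Gamma>) = (\<Sum>i = 1..n. select (f i) \<Delta>) \<rbrakk>
     \<Longrightarrow> GAl (\<Gamma> \<turnstile> \<Delta>)"
| tl: "GAl (\<Gamma> \<turnstile> \<Delta>) \<Longrightarrow> GAl (\<Gamma> + {#(x, \<^bold>t)#} \<turnstile> \<Delta>)"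
| tr: "GAl (\<Gamma> \<turnstile> \<Delta>) \<Longrightarrow> GAl (\<Gamma> \<turnstile> {#(x, \<^bold>t)#} + \<Delta>)"
| negl: "GAl (\<Gamma> \<turnstile> {#(x, A)#} + \<Delta>) \<Longrightarrow> GAl (\<Gamma> + {#(x, \<^bold>\<not> A)#} \<turnstile> \<Delta>)"
| negr: "GAl (\<Gamma> + {#(x, A)#} \<turnstile> \<Delta>) \<Longrightarrow> GAl (\<Gamma> \<turnstile> {#(x, \<^bold>\<not> A)#} + \<Delta>)"
| addl: "GAl (\<Gamma> + {#(x, A), (x, B)#} \<turnstile> \<Delta>) \<Longrightarrow> GAl (\<Gamma> + {#(x, A \<^bold>+ B)#} \<turnstile> \<Delta>)"
| addr: "GAl (\<Gamma> \<turnstile> \<Delta> + {#(x, A), (x, B)#}) \<Longrightarrow> GAl (\<Gamma> \<turnstile> \<Delta> + {#(x, A \<^bold>+ B)#})"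
| impl: "GAl (\<Gamma> + {#(x, B)#} \<turnstile> \<Delta> + {#(x, A)#}) \<Longrightarrow> GAl (\<Gamma> + {#(x, A \<^bold>\<rightarrow> B)#} \<turnstile> \<Delta>)"
| impr: "GAl (\<Gamma> + {#(x, A)#} \<turnstile> \<Delta> + {#(x, B)#}) \<Longrightarrow> GAl (\<Gamma> \<turnstile> \<Delta> + {#(x, A \<^bold>\<rightarrow> B)#})"
| limpl:
    "\<lbrakk> GAl (\<Gamma> + {#(x \<cdot> Atom y, B)#} \<turnstile> \<Delta> + {#(x \<cdot> Atom y, A)#});
       y \<notin> atoms_sequent (\<Gamma> + {#(x, A \<^bold>\<Rightarrow> B)#} \<turnstile> \<Delta>) \<rbrakk>
     \<Longrightarrow> GAl (\<Gamma> + {#(x, A \<^bold>\<Rightarrow> B)#} \<turnstile> \<Delta>)"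
| limpr:
    "\<lbrakk> GAl (\<Gamma> + {#(x, A)#} \<turnstile> \<Delta> + {#(x, B)#}); GAl (\<Gamma> \<turnstile> \<Delta>) \<rbrakk>
     \<Longrightarrow> GAl (\<Gamma> \<turnstile> \<Delta> + {#(x, A \<^bold>\<Rightarrow> B)#})"

end

theory Submission
  imports Defs
begin

definition weight :: "(nat \<Rightarrow> rat) \<Rightarrow> (label \<Rightarrow> nat) \<Rightarrow> lform multiset \<Rightarrow> rat" where
  "weight v f \<Gamma> = (\<Sum>A \<in># select f \<Gamma>. val v A)"

lemma weight_empty [simp]: "weight v f {#} = 0"
  by (simp add: weight_def select_def)

lemma weight_plus [simp]: "weight v f (\<Gamma> + \<Delta>) = weight v f \<Gamma> + weight v f \<Delta>"
  by (simp add: weight_def select_def)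

lemma weight_add_mset [simp]:
  "weight v f (add_mset (x, A) \<Gamma>) = (if f x = 1 then val v A else 0) + weight v f \<Gamma>"
  by (simp add: weight_def select_def)

lemma valid_iff_weight:
  "\<Turnstile>\<^sub>A (\<Gamma> \<turnstile> \<Delta>) \<longleftrightarrow> (\<forall>v. \<exists>f. labelling f \<and> weight v f \<Gamma> \<le> weight v f \<Delta>)"
  by (simp add: valid_def weight_def)

lemma valid_mono:
  assumes "\<Turnstile>\<^sub>A (\<Gamma> \<turnstile> \<Delta>)"
    and "\<And>v f. labelling f \<Longrightarrow> weight v f \<Gamma> \<le> weight v f \<Delta> \<Longrightarrow> weight v f \<Gamma>' \<le> weight v f \<Delta>'"
  shows "\<Turnstile>\<^sub>A (\<Gamma>' \<turnstile> \<Delta>')"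
  using assms unfolding valid_iff_weight by blast

lemma sum_mset_image_sum:
  "(\<Sum>A \<in># (\<Sum>i\<in>I. M i). g A) = (\<Sum>i\<in>I. \<Sum>A \<in># M i. g A)"
  by (induction I rule: infinite_finite_induct) auto

text \<open>The labellings balance the two sides only jointly, so which \<open>f i\<close> serves
  may depend on \<open>v\<close>: the weights have equal totals over \<open>i\<close>, hence the
  left cannot exceed the right at every \<open>i\<close>.\<close>

lemma valid_success:
  assumes "(n :: nat) \<ge> 1" "\<forall>i \<in> {1..n}. labelling (f i)"
    and eq: "(\<Sum>i = 1..n. select (f i) \<Gamma>) = (\<Sum>i = 1..n. select (f i) \<Delta>)"
  shows "\<Turnstile>\<^sub>A (\<Gamma> \<turnstile> \<Delta>)"
  unfolding valid_iff_weight
proof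
  fix v
  have "(\<Sum>i = 1..n. weight v (f i) \<Gamma>) = (\<Sum>i = 1..n. weight v (f i) \<Delta>)"
    using arg_cong[OF eq, of "\<lambda>M. \<Sum>A \<in># M. val v A"]
    by (simp add: sum_mset_image_sum weight_def)
  \<comment> \<open>Strict inequalities add up to a strict one only over a nonempty index
    set.\<close>
  moreover have "{1..n} \<noteq> {}"
    using \<open>n \<ge> 1\<close> by simp
  ultimately have "\<exists>i \<in> {1..n}. weight v (f i) \<Gamma> \<le> weight v (f i) \<Delta>"
    by (metis finite_atLeastAtMost less_irrefl not_le sum_strict_mono)
  then show "\<exists>f. labelling f \<and> weight v f \<Gamma> \<le> weight v f \<Delta>"
    using assms(2) by blast
qed

text \<open>The same labelling works for the conclusion, as
  \<open>f x * min 0 (b - a) \<le> f x * f y * (b - a)\<close> for \<open>a = val v A\<close>, \<open>b = val v B\<close>.\<close>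

lemma valid_limpl:
  assumes "\<Turnstile>\<^sub>A (\<Gamma> + {#(x \<cdot> y, B)#} \<turnstile> \<Delta> + {#(x \<cdot> y, A)#})"
  shows "\<Turnstile>\<^sub>A (\<Gamma> + {#(x, A \<^bold>\<Rightarrow> B)#} \<turnstile> \<Delta>)"
  using assms
proof (rule valid_mono)
  fix v f
  assume "labelling f"
    and le: "weight v f (\<Gamma> + {#(x \<cdot> y, B)#}) \<le> weight v f (\<Delta> + {#(x \<cdot> y, A)#})"
  then have "f (x \<cdot> y) = 1 \<longleftrightarrow> f x = 1 \<and> f y = 1"
    by (auto simp: labelling_def)
  with le show "weight v f (\<Gamma> + {#(x, A \<^bold>\<Rightarrow> B)#}) \<le> weight v f \<Delta>"
    by (auto simp: min_def split: if_splits)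
qed

lemma valid_limpr:
  assumes "\<Turnstile>\<^sub>A (\<Gamma> + {#(x, A)#} \<turnstile> \<Delta> + {#(x, B)#})" and "\<Turnstile>\<^sub>A (\<Gamma> \<turnstile> \<Delta>)"
  shows "\<Turnstile>\<^sub>A (\<Gamma> \<turnstile> \<Delta> + {#(x, A \<^bold>\<Rightarrow> B)#})"
  unfolding valid_iff_weight
proof
  fix v
  show "\<exists>f. labelling f \<and> weight v f \<Gamma> \<le> weight v f (\<Delta> + {#(x, A \<^bold>\<Rightarrow> B)#})"
  proof (cases "val v A \<le> val v B")
    case True
    then show ?thesis
      using assms(2) by (auto simp: valid_iff_weight)
  next
    case False
    obtain f where "labelling f"
      "weight v f (\<Gamma> + {#(x, A)#}) \<le> weight v f (\<Delta> + {#(x, B)#})"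
      using assms(1) unfolding valid_iff_weight by blast
    with False have "labelling f \<and> weight v f \<Gamma> \<le> weight v f (\<Delta> + {#(x, A \<^bold>\<Rightarrow> B)#})"
      by (auto split: if_splits)
    then show ?thesis by blast
  qed
qed

theorem mainTheorem13:
  fixes S :: lsequent
  assumes "GAl S"
  shows "\<Turnstile>\<^sub>A S"
  using assms
proof induction
  case success
  then show ?case by (blast intro: valid_success)
next
  case limpl
  then show ?case by (blast intro: valid_limpl)
next
  case limpr
  then show ?case by (blast intro: valid_limpr)
\<comment> \<open>In the eight remaining rules the right weight minus the left weight is the same
  for premise and conclusion under every labelling.\<close>
qed (erule valid_mono, simp split: if_splits)+

end
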